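(* Let $p$ be a prime, $m\in\mathbb{Z}$, and $D=p^{-m}\mathbb{Z}_p\subset\mathbb{Q}_p$, where $\mathbb{Q}_p$ is identified with its dual group. Let $\mathcal{H}_D$ be the space of functions in $L^2(\mathbb{Q}_p)$ whose Fourier transform is supported on $D$, each identified with its continuous representative. Let $S\subset\mathbb{Q}_p$ be a set of representatives for the quotient $\mathbb{Q}_p/p^m\mathbb{Z}_p$. Then for every $f\in\mathcal{H}_D$ and every $x\in\mathbb{Q}_p$, $$f(x)=\sum_{s\in S}\mathbf{1}_{s+p^m\mathbb{Z}_p}(x)\,f(s).$$
   Context: Haar measure on $\mathbb{Q}_p$ is normalized by $\mu(\mathbb{Z}_p)=1$. Let $\psi:\mathbb{Q}_p\to\mathbb{C}^*$ be the character $\psi(x)=e^{2\pi i x_0}$, where $x_0$ is any element of $\mathbb{Z}[1/p]$ with $x-x_0\in\mathbb{Z}_p$. The dual group of $\mathbb{Q}_p$ is identified with $\mathbb{Q}_p$ by sending $y$ to the character $x\mapsto\psi(xy)$, so the Fourier transform is $\hat f(y)=\int_{\mathbb{Q}_p}f(x)\overline{\psi(xy)}\,d\mu(x)$ for $f\in L^1\cap L^2$, extended to $L^2(\mathbb{Q}_p)$. The continuous representative of $f\in\mathcal{H}_D$ is $x\mapsto\int_D\hat f(y)\psi(xy)\,d\mu(y)$. $\mathbf{1}_E$ denotes the indicator function of $E$. *)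

theory Defs
  imports "HOL-Analysis.Analysis" "HOL-Computational_Algebra.Squarefree" "Berlekamp_Zassenhaus.Finite_Field"
begin

section \<open>The p-adic absolute value on the rationals\<close>

definition padic_abs :: "nat \<Rightarrow> rat \<Rightarrow> real" where
  "padic_abs p x = (if x = 0 then 0 else
     real p powi (int (multiplicity (int p) (snd (quotient_of x)))
                - int (multiplicity (int p) (fst (quotient_of x)))))"

lemma padic_abs_0 [simp]: "padic_abs p 0 = 0"
  by (simp add: padic_abs_def)

lemma padic_abs_frac:
  assumes p: "prime p" and a: "a \<noteq> 0" and b: "b \<noteq> 0"
  shows "padic_abs p (of_int a / of_int b) =
    real p powi (int (multiplicity (int p) b) - int (multiplicity (int p) a))"
proof -
  obtain c d where cd: "quotient_of (of_int a / of_int b) = (c, d)"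
    by fastforce
  have d: "d > 0" and eq: "of_int a / of_int b = (of_int c / of_int d :: rat)"
    using quotient_of_denom_pos[OF cd] quotient_of_div[OF cd] by auto
  have c: "c \<noteq> 0" using eq a b d by auto
  have "of_int (a * d) = (of_int (c * b) :: rat)"
    using eq b d by (simp add: field_simps)
  then have "a * d = c * b" by linarith
  then have "multiplicity (int p) (a * d) = multiplicity (int p) (c * b)" by simp
  moreover have "prime_elem (int p)" using p by simp
  ultimately have "multiplicity (int p) a + multiplicity (int p) d
      = multiplicity (int p) c + multiplicity (int p) b"
    using a b c d by (simp add: prime_elem_multiplicity_mult_distrib)
  then have "int (multiplicity (int p) d) - int (multiplicity (int p) c)
      = int (multiplicity (int p) b) - int (multiplicity (int p) a)" by linarith
  then show ?thesis using a b by (simp add: padic_abs_def cd)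
qed

lemma rat_frac_cases:
  obtains (zero) "(x::rat) = 0"
  | (frac) a b where "a \<noteq> 0" "b \<noteq> 0" "x = of_int a / of_int b"
proof (cases "x = 0")
  case False
  obtain c d where cd: "quotient_of x = (c, d)" by fastforce
  show ?thesis
    using that(2)[of c d] False quotient_of_denom_pos[OF cd] quotient_of_div[OF cd] by auto
qed (use that in auto)

lemma padic_abs_nonneg [simp]: "padic_abs p x \<ge> 0"
  by (simp add: padic_abs_def)

lemma padic_abs_eq_0_iff: "prime p \<Longrightarrow> padic_abs p x = 0 \<longleftrightarrow> x = 0"
  by (auto simp: padic_abs_def prime_gt_0_nat)

lemma padic_abs_1 [simp]: "padic_abs p 1 = 1"
  by (simp add: padic_abs_def)

lemma padic_abs_mult:
  assumes p: "prime p"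
  shows "padic_abs p (x * y) = padic_abs p x * padic_abs p y"
proof (cases x rule: rat_frac_cases)
  case (frac a b)
  note x = this
  show ?thesis
  proof (cases y rule: rat_frac_cases)
    case (frac c d)
    have pe: "prime_elem (int p)" using p by simp
    have p0: "real p \<noteq> 0" using p by (simp add: prime_gt_0_nat)
    let ?v = "\<lambda>a. int (multiplicity (int p) a)"
    have "x * y = of_int (a * c) / of_int (b * d)"
      using x frac by simp
    then have "padic_abs p (x * y) = real p powi (?v (b * d) - ?v (a * c))"
      using x frac padic_abs_frac[OF p, of "a * c" "b * d"] by simp
    also have "?v (b * d) - ?v (a * c) = (?v b - ?v a) + (?v d - ?v c)"
      using x frac pe by (simp add: prime_elem_multiplicity_mult_distrib)
    also have "real p powi \<dots> = padic_abs p x * padic_abs p y"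
      using x frac padic_abs_frac[OF p, of a b] padic_abs_frac[OF p, of c d] p0
      by (simp add: power_int_add)
    finally show ?thesis .
  qed auto
qed auto

lemma padic_abs_minus [simp]: "padic_abs p (- x) = padic_abs p x"
  by (simp add: padic_abs_def rat_uminus_code Let_def case_prod_unfold)

lemma padic_abs_minus_commute: "padic_abs p (x - y) = padic_abs p (y - x)"
  using padic_abs_minus[of p "x - y"] by simp

lemma padic_abs_add_le_max:
  assumes p: "prime p"
  shows "padic_abs p (x + y) \<le> max (padic_abs p x) (padic_abs p y)"
proof (cases "x = 0 \<or> y = 0 \<or> x + y = 0")
  case True
  then show ?thesis by (auto simp: le_max_iff_disj)
next
  case False
  have p1: "real p > 1" using prime_gt_1_nat[OF p] by simp
  obtain a b where x: "a \<noteq> 0" "b \<noteq> 0" "x = of_int a / of_int b"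
    using False by (cases x rule: rat_frac_cases) auto
  obtain c d where y: "c \<noteq> 0" "d \<noteq> 0" "y = of_int c / of_int d"
    using False by (cases y rule: rat_frac_cases) auto
  define u v w where "u = a * d" and "v = c * b" and "w = b * d"
  have w: "w \<noteq> 0" and u: "u \<noteq> 0" and v: "v \<noteq> 0"
    using x y by (auto simp: u_def v_def w_def)
  have xu: "x = of_int u / of_int w" and yv: "y = of_int v / of_int w"
    using x y by (auto simp: u_def v_def w_def)
  have xy: "x + y = of_int (u + v) / of_int w"
    using xu yv by (simp add: add_divide_distrib)
  have uv: "u + v \<noteq> 0" using False xy by auto
  define n where "n = min (multiplicity (int p) u) (multiplicity (int p) v)"
  have "int p ^ n dvd u + v"
    by (intro dvd_add multiplicity_dvd') (auto simp: n_def)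
  then have "multiplicity (int p) (u + v) \<ge> n"
    using uv prime_gt_1_nat[OF p] by (intro multiplicity_geI) auto
  then have le: "real p powi (int (multiplicity (int p) w) - int (multiplicity (int p) (u + v)))
      \<le> real p powi (int (multiplicity (int p) w) - int n)"
    using p1 by (intro power_int_increasing) auto
  have "real p powi (int (multiplicity (int p) w) - int n) = max (padic_abs p x) (padic_abs p y) \<or>
        real p powi (int (multiplicity (int p) w) - int n) \<le> max (padic_abs p x) (padic_abs p y)"
    unfolding xu yv padic_abs_frac[OF p u w] padic_abs_frac[OF p v w]
    by (auto simp: n_def min_def)
  then show ?thesis
    using le unfolding xy padic_abs_frac[OF p uv w] by linarith
qed

lemma padic_abs_add_le:
  "prime p \<Longrightarrow> padic_abs p (x + y) \<le> padic_abs p x + padic_abs p y"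
  using padic_abs_add_le_max[of p x y] padic_abs_nonneg[of p x] padic_abs_nonneg[of p y] by linarith

lemma padic_abs_diff_abs_le:
  assumes p: "prime p"
  shows "\<bar>padic_abs p x - padic_abs p y\<bar> \<le> padic_abs p (x - y)"
  using padic_abs_add_le[OF p, of "x - y" y] padic_abs_add_le[OF p, of "y - x" x]
  by (simp add: padic_abs_minus_commute[of p y x])

lemma padic_abs_inverse:
  assumes p: "prime p"
  shows "padic_abs p (inverse x) = inverse (padic_abs p x)"
proof (cases "x = 0")
  case False
  then have "padic_abs p x * padic_abs p (inverse x) = 1"
    by (simp flip: padic_abs_mult[OF p])
  then show ?thesis by (metis inverse_unique)
qed auto


section \<open>The field of p-adic numbers\<close>

definition padic_Cauchy :: "nat \<Rightarrow> (nat \<Rightarrow> rat) \<Rightarrow> bool" where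
  "padic_Cauchy p X \<longleftrightarrow> (\<forall>e>0. \<exists>N. \<forall>m\<ge>N. \<forall>n\<ge>N. padic_abs p (X m - X n) < e)"

definition padic_vanishes :: "nat \<Rightarrow> (nat \<Rightarrow> rat) \<Rightarrow> bool" where
  "padic_vanishes p X \<longleftrightarrow> (\<lambda>n. padic_abs p (X n)) \<longlonglongrightarrow> 0"

definition padic_rel :: "nat \<Rightarrow> (nat \<Rightarrow> rat) \<Rightarrow> (nat \<Rightarrow> rat) \<Rightarrow> bool" where
  "padic_rel p X Y \<longleftrightarrow>
     padic_Cauchy p X \<and> padic_Cauchy p Y \<and> padic_vanishes p (\<lambda>n. X n - Y n)"

lemma padic_vanishes_const_iff: "prime p \<Longrightarrow> padic_vanishes p (\<lambda>n. c) \<longleftrightarrow> c = 0"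
  by (simp add: padic_vanishes_def LIMSEQ_const_iff padic_abs_eq_0_iff)

lemma padic_vanishes_0 [simp]: "padic_vanishes p (\<lambda>n. 0)"
  by (simp add: padic_vanishes_def)

lemma padic_vanishes_add:
  assumes "prime p" "padic_vanishes p X" "padic_vanishes p Y"
  shows "padic_vanishes p (\<lambda>n. X n + Y n)"
  unfolding padic_vanishes_def
proof (rule tendsto_sandwich[OF _ _ tendsto_const])
  show "(\<lambda>n. padic_abs p (X n) + padic_abs p (Y n)) \<longlonglongrightarrow> 0"
    using tendsto_add[of "\<lambda>n. padic_abs p (X n)" 0 _ "\<lambda>n. padic_abs p (Y n)" 0] assms
    by (simp add: padic_vanishes_def)
qed (auto simp: padic_abs_add_le assms)

lemma padic_vanishes_minus_iff: "padic_vanishes p (\<lambda>n. - X n) \<longleftrightarrow> padic_vanishes p X"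
  by (simp add: padic_vanishes_def)

lemma padic_Cauchy_const [simp]: "padic_Cauchy p (\<lambda>n. c)"
  by (simp add: padic_Cauchy_def)

lemma padic_Cauchy_minus: "padic_Cauchy p X \<Longrightarrow> padic_Cauchy p (\<lambda>n. - X n)"
  unfolding padic_Cauchy_def minus_diff_minus padic_abs_minus .

lemma padic_Cauchy_add:
  assumes p: "prime p" and X: "padic_Cauchy p X" and Y: "padic_Cauchy p Y"
  shows "padic_Cauchy p (\<lambda>n. X n + Y n)"
  unfolding padic_Cauchy_def
proof (intro allI impI)
  fix e :: real assume e: "e > 0"
  obtain M where M: "\<And>m n. m \<ge> M \<Longrightarrow> n \<ge> M \<Longrightarrow> padic_abs p (X m - X n) < e"
    using X e unfolding padic_Cauchy_def by meson
  obtain N where N: "\<And>m n. m \<ge> N \<Longrightarrow> n \<ge> N \<Longrightarrow> padic_abs p (Y m - Y n) < e"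
    using Y e unfolding padic_Cauchy_def by meson
  have "padic_abs p (X m + Y m - (X n + Y n)) < e" if "m \<ge> max M N" "n \<ge> max M N" for m n
    using padic_abs_add_le_max[OF p, of "X m - X n" "Y m - Y n"] M[of m n] N[of m n] that
    by (simp add: algebra_simps)
  then show "\<exists>N. \<forall>m\<ge>N. \<forall>n\<ge>N. padic_abs p (X m + Y m - (X n + Y n)) < e" by blast
qed

lemma padic_Cauchy_diff:
  "prime p \<Longrightarrow> padic_Cauchy p X \<Longrightarrow> padic_Cauchy p Y \<Longrightarrow> padic_Cauchy p (\<lambda>n. X n - Y n)"
  using padic_Cauchy_add[of p X "\<lambda>n. - Y n"] padic_Cauchy_minus[of p Y] by simp

lemma padic_Cauchy_imp_Cauchy_abs:
  assumes p: "prime p" and X: "padic_Cauchy p X"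
  shows "Cauchy (\<lambda>n. padic_abs p (X n))"
  unfolding Cauchy_def dist_real_def
proof (intro allI impI)
  fix e :: real assume "e > 0"
  then obtain N where "\<And>m n. m \<ge> N \<Longrightarrow> n \<ge> N \<Longrightarrow> padic_abs p (X m - X n) < e"
    using X unfolding padic_Cauchy_def by meson
  then show "\<exists>N. \<forall>m\<ge>N. \<forall>n\<ge>N. \<bar>padic_abs p (X m) - padic_abs p (X n)\<bar> < e"
    using padic_abs_diff_abs_le[OF p] le_less_trans by (intro exI[of _ N]) blast
qed

lemma padic_Cauchy_convergent:
  "prime p \<Longrightarrow> padic_Cauchy p X \<Longrightarrow> convergent (\<lambda>n. padic_abs p (X n))"
  using padic_Cauchy_imp_Cauchy_abs real_Cauchy_convergent by blast

lemma padic_Cauchy_bounded: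
  assumes "prime p" "padic_Cauchy p X"
  obtains B where "B > 0" "\<And>n. padic_abs p (X n) \<le> B"
proof -
  have "Bseq (\<lambda>n. padic_abs p (X n))"
    using padic_Cauchy_convergent[OF assms] convergent_imp_Bseq by blast
  then show ?thesis using that by (auto simp: Bseq_def)
qed

lemma padic_vanishes_mult:
  assumes p: "prime p" and X: "padic_Cauchy p X" and Y: "padic_vanishes p Y"
  shows "padic_vanishes p (\<lambda>n. X n * Y n)"
proof -
  obtain B where B: "B > 0" "\<And>n. padic_abs p (X n) \<le> B"
    using padic_Cauchy_bounded[OF p X] by metis
  show ?thesis
    unfolding padic_vanishes_def
  proof (rule tendsto_sandwich[OF _ _ tendsto_const])
    show "(\<lambda>n. B * padic_abs p (Y n)) \<longlonglongrightarrow> 0"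
      using tendsto_mult_right_zero Y unfolding padic_vanishes_def by blast
  qed (auto simp: padic_abs_mult[OF p] B mult_right_mono)
qed

lemma padic_Cauchy_mult:
  assumes p: "prime p" and X: "padic_Cauchy p X" and Y: "padic_Cauchy p Y"
  shows "padic_Cauchy p (\<lambda>n. X n * Y n)"
  unfolding padic_Cauchy_def
proof (intro allI impI)
  fix e :: real assume e: "e > 0"
  obtain A where A: "A > 0" "\<And>n. padic_abs p (X n) \<le> A"
    using padic_Cauchy_bounded[OF p X] by metis
  obtain B where B: "B > 0" "\<And>n. padic_abs p (Y n) \<le> B"
    using padic_Cauchy_bounded[OF p Y] by metis
  obtain M where M: "\<And>m n. m \<ge> M \<Longrightarrow> n \<ge> M \<Longrightarrow> padic_abs p (X m - X n) < e / B"
    using X e B unfolding padic_Cauchy_def by (meson divide_pos_pos)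
  obtain N where N: "\<And>m n. m \<ge> N \<Longrightarrow> n \<ge> N \<Longrightarrow> padic_abs p (Y m - Y n) < e / A"
    using Y e A unfolding padic_Cauchy_def by (meson divide_pos_pos)
  have "padic_abs p (X m * Y m - X n * Y n) < e" if "m \<ge> max M N" "n \<ge> max M N" for m n
  proof -
    have "padic_abs p (X m) * padic_abs p (Y m - Y n) \<le> A * padic_abs p (Y m - Y n)"
      by (intro mult_right_mono A) auto
    also have "\<dots> < e" using N[of m n] that A by (simp add: field_simps)
    finally have 1: "padic_abs p (X m * (Y m - Y n)) < e" by (simp add: padic_abs_mult[OF p])
    have "padic_abs p (X m - X n) * padic_abs p (Y n) \<le> padic_abs p (X m - X n) * B"
      by (intro mult_left_mono B) auto
    also have "\<dots> < e" using M[of m n] that B by (simp add: field_simps)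
    finally have 2: "padic_abs p ((X m - X n) * Y n) < e" by (simp add: padic_abs_mult[OF p])
    show ?thesis
      using padic_abs_add_le_max[OF p, of "X m * (Y m - Y n)" "(X m - X n) * Y n"] 1 2
      by (simp add: algebra_simps)
  qed
  then show "\<exists>N. \<forall>m\<ge>N. \<forall>n\<ge>N. padic_abs p (X m * Y m - X n * Y n) < e" by blast
qed

lemma padic_not_vanishes_lower_bound:
  assumes p: "prime p" and X: "padic_Cauchy p X" and nz: "\<not> padic_vanishes p X"
  obtains b where "b > 0" "eventually (\<lambda>n. padic_abs p (X n) > b) sequentially"
proof -
  obtain L where L: "(\<lambda>n. padic_abs p (X n)) \<longlonglongrightarrow> L"
    using padic_Cauchy_convergent[OF p X] by (auto simp: convergent_def)
  have "L \<ge> 0" by (rule LIMSEQ_le_const[OF L]) auto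
  moreover have "L \<noteq> 0" using L nz by (auto simp: padic_vanishes_def)
  ultimately have "L > 0" by simp
  then show ?thesis
    using that[of "L/2"] order_tendstoD(1)[OF L, of "L/2"] by simp
qed

lemma padic_Cauchy_inverse:
  assumes p: "prime p" and X: "padic_Cauchy p X" and nz: "\<not> padic_vanishes p X"
  shows "padic_Cauchy p (\<lambda>n. inverse (X n))"
  unfolding padic_Cauchy_def
proof (intro allI impI)
  fix e :: real assume e: "e > 0"
  obtain b where b: "b > 0" and "eventually (\<lambda>n. padic_abs p (X n) > b) sequentially"
    using padic_not_vanishes_lower_bound[OF assms] by blast
  then obtain M where M: "\<And>n. n \<ge> M \<Longrightarrow> padic_abs p (X n) > b"
    by (auto simp: eventually_sequentially)
  obtain N where N: "\<And>m n. m \<ge> N \<Longrightarrow> n \<ge> N \<Longrightarrow> padic_abs p (X m - X n) < e * (b * b)"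
    using X e b unfolding padic_Cauchy_def by (meson mult_pos_pos)
  have "padic_abs p (inverse (X m) - inverse (X n)) < e" if "m \<ge> max M N" "n \<ge> max M N" for m n
  proof -
    have bm: "padic_abs p (X m) > b" and bn: "padic_abs p (X n) > b" using M that by auto
    then have nz: "X m \<noteq> 0" "X n \<noteq> 0" using b by auto
    have "inverse (X m) - inverse (X n) = inverse (X m) * inverse (X n) * (X n - X m)"
      using nz by (simp add: field_simps)
    then have "padic_abs p (inverse (X m) - inverse (X n))
        = padic_abs p (X n - X m) / (padic_abs p (X m) * padic_abs p (X n))"
      by (simp only: padic_abs_mult[OF p] padic_abs_inverse[OF p]) (simp add: divide_inverse)
    also have "\<dots> \<le> padic_abs p (X n - X m) / (b * b)"
      using bm bn b by (intro divide_left_mono mult_mono mult_pos_pos) auto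
    also have "\<dots> < e" using N[of n m] that b by (simp add: field_simps)
    finally show ?thesis .
  qed
  then show "\<exists>N. \<forall>m\<ge>N. \<forall>n\<ge>N. padic_abs p (inverse (X m) - inverse (X n)) < e" by blast
qed

lemma padic_rel_sym: "padic_rel p X Y \<Longrightarrow> padic_rel p Y X"
  by (simp add: padic_rel_def padic_vanishes_def padic_abs_minus_commute)

lemma part_equivp_padic_rel:
  "part_equivp (padic_rel CARD('p::prime_card))"
proof (rule part_equivpI)
  show "\<exists>X. padic_rel CARD('p) X X"
    by (rule exI[of _ "\<lambda>n. 0"]) (simp add: padic_rel_def)
  show "symp (padic_rel CARD('p))" by (auto intro: sympI padic_rel_sym)
  show "transp (padic_rel CARD('p))"
  proof (rule transpI)
    fix X Y Z assume "padic_rel CARD('p) X Y" "padic_rel CARD('p) Y Z"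
    then show "padic_rel CARD('p) X Z"
      using padic_vanishes_add[OF prime_card[where 'a='p], of "\<lambda>n. X n - Y n" "\<lambda>n. Y n - Z n"]
      by (simp add: padic_rel_def)
  qed
qed

text \<open>For a type \<open>'p\<close> with a prime number \<open>p\<close> of elements, \<open>'p padic\<close> is the completion of the
  rationals with respect to the \<open>p\<close>-adic absolute value; only the cardinality of \<open>'p\<close> matters.\<close>

typedef ('p::prime_card) padic =
  "{C. \<exists>X. padic_rel CARD('p) X X \<and> C = Collect (padic_rel CARD('p) X)}"
proof -
  have "padic_rel CARD('p) (\<lambda>n. 0) (\<lambda>n. 0)" by (simp add: padic_rel_def)
  then show ?thesis by blast
qed

definition Padic :: "(nat \<Rightarrow> rat) \<Rightarrow> 'p::prime_card padic" where
  "Padic X = Abs_padic (Collect (padic_rel CARD('p) X))"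

definition rep_padic :: "'p::prime_card padic \<Rightarrow> nat \<Rightarrow> rat" where
  "rep_padic x = (SOME X. X \<in> Rep_padic x)"

definition cr_padic :: "(nat \<Rightarrow> rat) \<Rightarrow> 'p::prime_card padic \<Rightarrow> bool" where
  "cr_padic X x \<longleftrightarrow> padic_rel CARD('p) X X \<and> Padic X = x"

lemma Quotient_padic:
  "Quotient (padic_rel CARD('p::prime_card)) (Padic :: _ \<Rightarrow> 'p padic) rep_padic cr_padic"
proof -
  interpret quot_type "padic_rel CARD('p)" "Abs_padic :: _ \<Rightarrow> 'p padic" Rep_padic
    by (rule quot_type.intro)
      (use Rep_padic in \<open>auto simp: part_equivp_padic_rel Rep_padic_inverse Rep_padic_inject
        intro!: Abs_padic_inverse\<close>)
  have abs_eq: "abs = (Padic :: _ \<Rightarrow> 'p padic)"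
    by (auto simp: fun_eq_iff abs_def Padic_def)
  have rep_eq: "rep = (rep_padic :: 'p padic \<Rightarrow> _)"
    by (auto simp: fun_eq_iff rep_def rep_padic_def)
  show ?thesis
    by (rule Quotient3_to_Quotient[OF Quotient[unfolded abs_eq rep_eq]])
      (rule eq_reflection, auto simp: fun_eq_iff cr_padic_def)
qed

setup_lifting Quotient_padic

lemma Padic_induct:
  assumes "\<And>X. padic_Cauchy CARD('p::prime_card) X \<Longrightarrow> P (Padic X :: 'p padic)"
  shows "P x"
  using assms[of "rep_padic x"] Quotient_abs_rep[OF Quotient_padic, of x]
    Quotient_rep_reflp[OF Quotient_padic, of x]
  by (simp add: padic_rel_def)

instantiation padic :: (prime_card) comm_ring_1
begin

lift_definition zero_padic :: "'a padic" is "\<lambda>n. 0"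
  by (simp add: padic_rel_def)

lift_definition one_padic :: "'a padic" is "\<lambda>n. 1"
  by (simp add: padic_rel_def)

lift_definition plus_padic :: "'a padic \<Rightarrow> 'a padic \<Rightarrow> 'a padic" is "\<lambda>X Y n. X n + Y n"
proof -
  fix X X' Y Y' assume a: "padic_rel CARD('a) X X'" "padic_rel CARD('a) Y Y'"
  have "padic_vanishes CARD('a) (\<lambda>n. (X n - X' n) + (Y n - Y' n))"
    using a by (intro padic_vanishes_add) (auto simp: padic_rel_def prime_card)
  then show "padic_rel CARD('a) (\<lambda>n. X n + Y n) (\<lambda>n. X' n + Y' n)"
    using a by (auto simp: padic_rel_def prime_card padic_Cauchy_add algebra_simps)
qed

lift_definition uminus_padic :: "'a padic \<Rightarrow> 'a padic" is "\<lambda>X n. - X n"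
proof -
  fix X X' assume a: "padic_rel CARD('a) X X'"
  have "padic_vanishes CARD('a) (\<lambda>n. - (X n - X' n))"
    using a by (simp only: padic_vanishes_minus_iff) (simp add: padic_rel_def)
  then show "padic_rel CARD('a) (\<lambda>n. - X n) (\<lambda>n. - X' n)"
    using a by (auto simp: padic_rel_def padic_Cauchy_minus)
qed

lift_definition minus_padic :: "'a padic \<Rightarrow> 'a padic \<Rightarrow> 'a padic" is "\<lambda>X Y n. X n - Y n"
proof -
  fix X X' Y Y' assume a: "padic_rel CARD('a) X X'" "padic_rel CARD('a) Y Y'"
  have "padic_vanishes CARD('a) (\<lambda>n. (X n - X' n) + - (Y n - Y' n))"
    using a by (intro padic_vanishes_add padic_vanishes_minus_iff[THEN iffD2])
      (auto simp: padic_rel_def prime_card)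
  then show "padic_rel CARD('a) (\<lambda>n. X n - Y n) (\<lambda>n. X' n - Y' n)"
    using a by (auto simp: padic_rel_def prime_card padic_Cauchy_diff algebra_simps)
qed

lift_definition times_padic :: "'a padic \<Rightarrow> 'a padic \<Rightarrow> 'a padic" is "\<lambda>X Y n. X n * Y n"
proof -
  fix X X' Y Y' assume a: "padic_rel CARD('a) X X'" "padic_rel CARD('a) Y Y'"
  have "padic_vanishes CARD('a) (\<lambda>n. X n * (Y n - Y' n) + Y' n * (X n - X' n))"
    using a by (intro padic_vanishes_add padic_vanishes_mult) (auto simp: padic_rel_def prime_card)
  then show "padic_rel CARD('a) (\<lambda>n. X n * Y n) (\<lambda>n. X' n * Y' n)"
    using a by (auto simp: padic_rel_def prime_card padic_Cauchy_mult algebra_simps)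
qed

instance
proof
  note [simp] = prime_card padic_Cauchy_add padic_Cauchy_mult padic_Cauchy_minus
    padic_Cauchy_diff
  fix a b c :: "'a padic"
  show "a + b + c = a + (b + c)"
    by transfer (simp add: padic_rel_def add.assoc)
  show "a + b = b + a"
    by transfer (simp add: padic_rel_def add.commute)
  show "0 + a = a"
    by transfer (simp add: padic_rel_def)
  show "- a + a = 0"
    by transfer (simp add: padic_rel_def)
  show "a - b = a + - b"
    by transfer (simp add: padic_rel_def)
  show "a * b * c = a * (b * c)"
    by transfer (simp add: padic_rel_def mult.assoc)
  show "a * b = b * a"
    by transfer (simp add: padic_rel_def mult.commute)
  show "1 * a = a"
    by transfer (simp add: padic_rel_def)
  show "(a + b) * c = a * c + b * c"
    by transfer (simp add: padic_rel_def distrib_right)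
  show "(0::'a padic) \<noteq> 1"
    by transfer (simp add: padic_rel_def padic_vanishes_def LIMSEQ_const_iff)
qed

end

lemma Padic_eq_iff:
  assumes "padic_Cauchy CARD('p::prime_card) X" "padic_Cauchy CARD('p) Y"
  shows "(Padic X :: 'p padic) = Padic Y \<longleftrightarrow> padic_vanishes CARD('p) (\<lambda>n. X n - Y n)"
  using Quotient_rel[OF Quotient_padic[where 'p='p], of X Y] assms by (auto simp: padic_rel_def)

lemma zero_Padic: "(0 :: 'p::prime_card padic) = Padic (\<lambda>n. 0)"
  by (fact zero_padic.abs_eq)

lemma one_Padic: "(1 :: 'p::prime_card padic) = Padic (\<lambda>n. 1)"
  by (fact one_padic.abs_eq)

context
  fixes X Y :: "nat \<Rightarrow> rat"
  assumes XY: "padic_Cauchy CARD('p::prime_card) X" "padic_Cauchy CARD('p) Y"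
begin

lemma plus_Padic: "(Padic X :: 'p padic) + Padic Y = Padic (\<lambda>n. X n + Y n)"
  by (rule plus_padic.abs_eq) (simp_all add: padic_rel_def XY)

lemma minus_Padic: "(Padic X :: 'p padic) - Padic Y = Padic (\<lambda>n. X n - Y n)"
  by (rule minus_padic.abs_eq) (simp_all add: padic_rel_def XY)

lemma times_Padic: "(Padic X :: 'p padic) * Padic Y = Padic (\<lambda>n. X n * Y n)"
  by (rule times_padic.abs_eq) (simp_all add: padic_rel_def XY)

end

lemma padic_ex_inverse:
  fixes x :: "'p::prime_card padic"
  assumes "x \<noteq> 0"
  shows "\<exists>y. y * x = 1"
  using assms
proof (induct x rule: Padic_induct)
  case (1 X)
  have nz: "\<not> padic_vanishes CARD('p) X"
    using 1 Padic_eq_iff[where 'p='p, of X "\<lambda>n. 0"] by (simp add: zero_Padic)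
  obtain b where b: "b > 0" and ev: "eventually (\<lambda>n. padic_abs CARD('p) (X n) > b) sequentially"
    using padic_not_vanishes_lower_bound[OF prime_card 1(1) nz] by blast
  have inv: "padic_Cauchy CARD('p) (\<lambda>n. inverse (X n))"
    by (rule padic_Cauchy_inverse[OF prime_card 1(1) nz])
  have "eventually (\<lambda>n. padic_abs CARD('p) (inverse (X n) * X n - 1) = 0) sequentially"
    using ev
  proof eventually_elim
    case (elim n)
    then have "X n \<noteq> 0" using b by auto
    then show ?case by simp
  qed
  then have "padic_vanishes CARD('p) (\<lambda>n. inverse (X n) * X n - 1)"
    unfolding padic_vanishes_def by (rule tendsto_eventually)
  then have "(Padic (\<lambda>n. inverse (X n)) :: 'p padic) * Padic X = 1"
    using 1(1) inv
    by (simp add: times_Padic one_Padic Padic_eq_iff padic_Cauchy_mult prime_card)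
  then show ?case by blast
qed

instantiation padic :: (prime_card) field
begin

definition inverse_padic :: "'a padic \<Rightarrow> 'a padic" where
  "inverse_padic x = (if x = 0 then 0 else (SOME y. y * x = 1))"

definition divide_padic :: "'a padic \<Rightarrow> 'a padic \<Rightarrow> 'a padic" where
  "divide_padic x y = x * inverse y"

instance
proof
  fix a b :: "'a padic"
  show "inverse a * a = 1" if "a \<noteq> 0"
    using someI_ex[OF padic_ex_inverse[OF that]] that by (simp add: inverse_padic_def)
  show "a div b = a * inverse b" by (simp add: divide_padic_def)
  show "inverse (0 :: 'a padic) = 0" by (simp add: inverse_padic_def)
qed

end

lemma of_nat_Padic: "(of_nat k :: 'p::prime_card padic) = Padic (\<lambda>n. of_nat k)"
  by (induct k) (simp_all add: zero_Padic one_Padic plus_Padic)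

instance padic :: (prime_card) field_char_0
proof
  show "inj (of_nat :: nat \<Rightarrow> 'a padic)"
    by (rule injI) (simp add: of_nat_Padic Padic_eq_iff padic_vanishes_const_iff prime_card)
qed

lemma of_int_Padic: "(of_int k :: 'p::prime_card padic) = Padic (\<lambda>n. of_int k)"
  by (cases k rule: int_diff_cases) (simp add: of_nat_Padic minus_Padic)

lemma of_rat_Padic: "(of_rat r :: 'p::prime_card padic) = Padic (\<lambda>n. r)"
proof (cases r)
  case (Fract a b)
  have "(Padic (\<lambda>n. r) :: 'p padic) * of_int b = of_int a"
    using Fract by (simp add: of_int_Padic times_Padic Fract_of_int_quotient)
  then show ?thesis
    using Fract by (simp add: of_rat_rat field_simps)
qed

lift_definition padic_norm :: "'p::prime_card padic \<Rightarrow> real" is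
  "\<lambda>X. lim (\<lambda>n. padic_abs CARD('p) (X n))"
proof -
  fix X Y assume a: "padic_rel CARD('p) X Y"
  note p = prime_card[where 'a='p]
  obtain L where L: "(\<lambda>n. padic_abs CARD('p) (Y n)) \<longlonglongrightarrow> L"
    using a padic_Cauchy_convergent[OF p] by (auto simp: padic_rel_def convergent_def)
  have "(\<lambda>n. padic_abs CARD('p) (X n) - padic_abs CARD('p) (Y n)) \<longlonglongrightarrow> 0"
  proof (rule Lim_null_comparison)
    show "(\<lambda>n. padic_abs CARD('p) (X n - Y n)) \<longlonglongrightarrow> 0"
      using a by (simp add: padic_rel_def padic_vanishes_def)
  qed (simp add: padic_abs_diff_abs_le[OF p])
  from tendsto_add[OF this L] have "(\<lambda>n. padic_abs CARD('p) (X n)) \<longlonglongrightarrow> L" by simp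
  then show "lim (\<lambda>n. padic_abs CARD('p) (X n)) = lim (\<lambda>n. padic_abs CARD('p) (Y n))"
    using L by (simp add: limI)
qed

lemma padic_norm_Padic:
  assumes "padic_Cauchy CARD('p::prime_card) X"
  shows "(\<lambda>n. padic_abs CARD('p) (X n)) \<longlonglongrightarrow> padic_norm (Padic X :: 'p padic)"
  using padic_Cauchy_convergent[OF prime_card assms] assms
  by (simp add: padic_norm.abs_eq padic_rel_def convergent_LIMSEQ_iff)

lemma padic_norm_of_rat: "padic_norm (of_rat r :: 'p::prime_card padic) = padic_abs CARD('p) r"
  using padic_norm_Padic[where 'p='p, of "\<lambda>n. r"] by (simp add: of_rat_Padic LIMSEQ_const_iff)

lemma padic_norm_eq_0_iff [simp]: "padic_norm (x :: 'p::prime_card padic) = 0 \<longleftrightarrow> x = 0"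
proof (induct x rule: Padic_induct)
  case (1 X)
  have "padic_norm (Padic X :: 'p padic) = 0 \<longleftrightarrow> padic_vanishes CARD('p) X"
    using padic_norm_Padic[OF 1] LIMSEQ_unique by (auto simp: padic_vanishes_def)
  then show ?case using 1 by (simp add: zero_Padic Padic_eq_iff)
qed

lemma padic_norm_0 [simp]: "padic_norm (0 :: 'p::prime_card padic) = 0"
  by simp

lemma padic_norm_mult: "padic_norm (x * y :: 'p::prime_card padic) = padic_norm x * padic_norm y"
proof (induct x rule: Padic_induct)
  case X: (1 X)
  show ?case
  proof (induct y rule: Padic_induct)
    case Y: (1 Y)
    have "(\<lambda>n. padic_abs CARD('p) (X n * Y n)) \<longlonglongrightarrow>
        padic_norm (Padic X :: 'p padic) * padic_norm (Padic Y :: 'p padic)"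
      unfolding padic_abs_mult[OF prime_card] by (intro tendsto_mult padic_norm_Padic X Y)
    then show ?case
      using padic_norm_Padic[OF padic_Cauchy_mult[OF prime_card X Y]] LIMSEQ_unique
      by (auto simp: times_Padic X Y)
  qed
qed

lemma padic_norm_add_le_max:
  "padic_norm (x + y :: 'p::prime_card padic) \<le> max (padic_norm x) (padic_norm y)"
proof (induct x rule: Padic_induct)
  case X: (1 X)
  show ?case
  proof (induct y rule: Padic_induct)
    case Y: (1 Y)
    have "(\<lambda>n. padic_abs CARD('p) (X n + Y n)) \<longlonglongrightarrow> padic_norm (Padic X + Padic Y :: 'p padic)"
      using padic_norm_Padic[OF padic_Cauchy_add[OF prime_card X Y]] by (simp add: plus_Padic X Y)
    moreover have "(\<lambda>n. max (padic_abs CARD('p) (X n)) (padic_abs CARD('p) (Y n))) \<longlonglongrightarrow>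
        max (padic_norm (Padic X :: 'p padic)) (padic_norm (Padic Y :: 'p padic))"
      by (intro tendsto_max padic_norm_Padic X Y)
    ultimately show ?case
      by (rule LIMSEQ_le) (simp add: padic_abs_add_le_max[OF prime_card])
  qed
qed

lemma padic_norm_minus [simp]: "padic_norm (- x :: 'p::prime_card padic) = padic_norm x"
proof -
  have "padic_norm (-1 :: 'p padic) = 1"
    using padic_norm_of_rat[where 'p='p, of "-1"] by (simp add: of_rat_minus)
  then show ?thesis using padic_norm_mult[of "-1" x] by simp
qed

lemma padic_norm_nonneg [simp]: "padic_norm (x :: 'p::prime_card padic) \<ge> 0"
  using padic_norm_add_le_max[of x "- x"] by (simp del: padic_norm_eq_0_iff)

instantiation padic :: (prime_card) metric_space
begin

definition dist_padic :: "'a padic \<Rightarrow> 'a padic \<Rightarrow> real" where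
  "dist_padic x y = padic_norm (x - y)"

definition uniformity_padic :: "('a padic \<times> 'a padic) filter" where
  "uniformity_padic = (INF e\<in>{0 <..}. principal {(x, y). dist x y < e})"

definition open_padic :: "'a padic set \<Rightarrow> bool" where
  "open_padic U \<longleftrightarrow> (\<forall>x\<in>U. eventually (\<lambda>(x', y). x' = x \<longrightarrow> y \<in> U) uniformity)"

instance
proof
  fix x y z :: "'a padic"
  show "dist x y = 0 \<longleftrightarrow> x = y" by (simp add: dist_padic_def)
  have "padic_norm (x - y) \<le> max (padic_norm (x - z)) (padic_norm (z - y))"
    using padic_norm_add_le_max[of "x - z" "z - y"] by simp
  also have "padic_norm (z - y) = padic_norm (y - z)"
    using padic_norm_minus[of "z - y"] by simp
  also have "max (padic_norm (x - z)) (padic_norm (y - z)) \<le> padic_norm (x - z) + padic_norm (y - z)"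
    using padic_norm_nonneg[of "x - z"] padic_norm_nonneg[of "y - z"] by linarith
  finally show "dist x y \<le> dist x z + dist y z" by (simp add: dist_padic_def)
qed (simp_all add: uniformity_padic_def open_padic_def)

end

definition padic_ints :: "'p::prime_card padic set" where
  "padic_ints = {x. padic_norm x \<le> 1}"

text \<open>The subgroup \<open>p\<^sup>k \<int>\<^sub>p\<close>, where \<open>k\<close> may be negative.\<close>

definition padic_ideal :: "int \<Rightarrow> 'p::prime_card padic set" where
  "padic_ideal k = (\<lambda>z. of_nat CARD('p) powi k * z) ` padic_ints"


section \<open>Haar measure and the standard character\<close>

text \<open>The normalization \<open>\<mu>(\<int>\<^sub>p) = 1\<close> together with translation invariance already forces \<open>\<mu>\<close> to be
  finite on compact sets, so these conditions determine the Haar measure.\<close>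

definition haar_measure :: "'p::prime_card padic measure \<Rightarrow> bool" where
  "haar_measure \<mu> \<longleftrightarrow> sets \<mu> = sets borel \<and>
     (\<forall>a. \<forall>A\<in>sets borel. emeasure \<mu> ((+) a ` A) = emeasure \<mu> A) \<and>
     emeasure \<mu> padic_ints = 1"

text \<open>The ring \<open>\<int>[1/p]\<close> inside the rationals.\<close>

definition p_fractions :: "nat \<Rightarrow> rat set" where
  "p_fractions p = {of_int a / of_nat p ^ k | a k. True}"

definition padic_char :: "'p::prime_card padic \<Rightarrow> complex" where
  "padic_char x = exp (2 * pi * \<i> *
     of_rat (SOME x0. x0 \<in> p_fractions CARD('p) \<and> x - of_rat x0 \<in> padic_ints))"

text \<open>The choice in \<open>padic_char\<close> is immaterial: \<open>ex_p_fraction\<close> gives existence, and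
  \<open>padic_char_eq\<close> shows that every admissible \<open>x0\<close> yields the same value.\<close>

lemma p_fractions_diff:
  assumes "p > 0" "x \<in> p_fractions p" "y \<in> p_fractions p"
  shows "x - y \<in> p_fractions p"
proof -
  obtain a k b l where xy: "x = of_int a / of_nat p ^ k" "y = of_int b / of_nat p ^ l"
    using assms by (auto simp: p_fractions_def)
  then have "x - y = of_int (a * int p ^ l - b * int p ^ k) / of_nat p ^ (k + l)"
    using assms(1) by (simp add: xy diff_frac_eq power_add)
  then show ?thesis unfolding p_fractions_def by blast
qed

lemma p_fractions_integral:
  assumes p: "prime p" and x: "x \<in> p_fractions p" and le: "padic_abs p x \<le> 1"
  shows "x \<in> \<int>"
proof -
  obtain a k where ak: "x = of_int a / of_int (int p ^ k)"
    using x by (auto simp: p_fractions_def)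
  have p1: "real p > 1" using prime_gt_1_nat[OF p] by simp
  show ?thesis
  proof (cases "a = 0")
    case False
    have "multiplicity (int p) (int p ^ k) = k"
      using p prime_gt_1_nat[OF p] by (intro multiplicity_same_power) auto
    then have "real p powi (int k - int (multiplicity (int p) a)) \<le> 1"
      using le padic_abs_frac[OF p False, of "int p ^ k"] p1 unfolding ak by simp
    then have "int k - int (multiplicity (int p) a) \<le> 0"
      using p1 power_int_strict_increasing[of 0 "int k - int (multiplicity (int p) a)" "real p"]
      by force
    then have "int p ^ k dvd a" by (intro multiplicity_dvd') simp
    then obtain c where "a = int p ^ k * c" by blast
    then have "x = of_int c" using ak p1 by simp
    then show ?thesis by simp
  qed (use ak in simp)
qed

lemma padic_abs_of_int_le_1:
  assumes p: "prime p"
  shows "padic_abs p (of_int a) \<le> 1"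
proof (cases "a = 0")
  case False
  then have "padic_abs p (of_int a) = inverse (real p ^ multiplicity (int p) a)"
    using padic_abs_frac[OF p False, of 1] by (simp add: power_int_minus)
  moreover have "real p ^ multiplicity (int p) a \<ge> 1"
    using prime_ge_1_nat[OF p] by (intro one_le_power) simp
  ultimately show ?thesis by (simp add: inverse_le_1_iff)
qed simp

lemma ex_p_fraction:
  fixes x :: "'p::prime_card padic"
  shows "\<exists>x0. x0 \<in> p_fractions CARD('p) \<and> x - of_rat x0 \<in> padic_ints"
proof (induct x rule: Padic_induct)
  case (1 X)
  let ?p = "CARD('p)"
  note p = prime_card[where 'a='p]
  obtain N where N: "\<And>m n. m \<ge> N \<Longrightarrow> n \<ge> N \<Longrightarrow> padic_abs ?p (X m - X n) < 1"
    using 1 unfolding padic_Cauchy_def by (metis zero_less_one)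
  have le1: "padic_norm (Padic X - of_rat (X N) :: 'p padic) \<le> 1"
  proof (rule LIMSEQ_le_const2)
    show "(\<lambda>n. padic_abs ?p (X n - X N)) \<longlonglongrightarrow> padic_norm (Padic X - of_rat (X N) :: 'p padic)"
      using padic_norm_Padic[OF padic_Cauchy_diff[OF p 1 padic_Cauchy_const]]
      by (simp add: of_rat_Padic minus_Padic 1)
    show "\<exists>M. \<forall>n\<ge>M. padic_abs ?p (X n - X N) \<le> 1"
      using N by (intro exI[of _ N]) (auto intro: less_imp_le)
  qed
  obtain a b where b: "b \<noteq> 0" and ab: "X N = of_int a / of_int b"
    by (metis Fract_of_int_quotient Rat_cases less_irrefl)
  obtain c where c: "b = int ?p ^ multiplicity (int ?p) b * c" "\<not> int ?p dvd c"
    using multiplicity_decompose'[of b "int ?p"] b p prime_gt_1_nat[OF p] by auto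
  define k where "k = multiplicity (int ?p) b"
  have "coprime c (int ?p ^ k)"
    using c(2) p prime_imp_coprime[of "int ?p" c] by (simp add: coprime_commute)
  then obtain u where u: "[c * u = 1] (mod int ?p ^ k)" using cong_solve_coprime_int by blast
  then have "[c * (u * a) = a] (mod int ?p ^ k)"
    using cong_scalar_right[OF u, of a] by (simp add: mult.assoc)
  then obtain e where e: "a - c * (u * a) = int ?p ^ k * e"
    unfolding cong_iff_dvd_diff by (metis dvdE dvd_diff_commute)
  have c0: "c \<noteq> 0" using c(2) by auto
  define x0 :: rat where "x0 = of_int (u * a) / of_nat ?p ^ k"
  have p0: "(of_nat ?p :: rat) \<noteq> 0" using p prime_gt_0_nat by auto
  have "X N - x0 = (of_int a - of_int c * of_int (u * a)) / (of_nat ?p ^ k * of_int c)"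
    using c(1)[folded k_def] c0 p0 unfolding ab x0_def by (simp add: field_simps)
  also have "of_int a - of_int c * of_int (u * a) = (of_int (a - c * (u * a)) :: rat)" by simp
  also have "\<dots> / (of_nat ?p ^ k * of_int c) = of_int e / of_int c"
    unfolding e using p0 by simp
  finally have "padic_abs ?p (X N - x0) = padic_abs ?p (of_int e) * padic_abs ?p (inverse (of_int c))"
    by (simp add: divide_inverse padic_abs_mult[OF p])
  also have "padic_abs ?p (inverse (of_int c)) = 1"
    using padic_abs_frac[OF p _ c0, of 1] c(2) by (simp add: divide_inverse not_dvd_imp_multiplicity_0)
  finally have "padic_norm (of_rat (X N) - of_rat x0 :: 'p padic) \<le> 1"
    using padic_abs_of_int_le_1[OF p, of e] by (simp add: padic_norm_of_rat flip: of_rat_diff)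
  then have "padic_norm (Padic X - of_rat x0 :: 'p padic) \<le> 1"
    using le1 padic_norm_add_le_max[of "Padic X - of_rat (X N) :: 'p padic" "of_rat (X N) - of_rat x0"]
    by simp
  moreover have "x0 \<in> p_fractions ?p" unfolding p_fractions_def x0_def by blast
  ultimately show ?case by (auto simp: padic_ints_def)
qed

lemma padic_char_eq:
  fixes x :: "'p::prime_card padic"
  assumes "x0 \<in> p_fractions CARD('p)" "x - of_rat x0 \<in> padic_ints"
  shows "padic_char x = exp (2 * pi * \<i> * of_rat x0)"
proof -
  note p = prime_card[where 'a='p]
  define x1 where "x1 = (SOME x0. x0 \<in> p_fractions CARD('p) \<and> x - of_rat x0 \<in> padic_ints)"
  have x1: "x1 \<in> p_fractions CARD('p)" "x - of_rat x1 \<in> padic_ints"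
    using someI_ex[OF ex_p_fraction[of x]] by (auto simp: x1_def)
  have "padic_norm (of_rat (x1 - x0) :: 'p padic)
      \<le> max (padic_norm (x - of_rat x0)) (padic_norm (x - of_rat x1))"
    using padic_norm_add_le_max[of "x - of_rat x0" "- (x - of_rat x1)"]
    by (simp only: padic_norm_minus) (simp add: of_rat_diff)
  then have "padic_abs CARD('p) (x1 - x0) \<le> 1"
    using assms x1 by (auto simp: padic_ints_def padic_norm_of_rat)
  then have "x1 - x0 \<in> \<int>"
    using p_fractions_integral[OF p p_fractions_diff] assms x1 prime_gt_0_nat[OF p] by blast
  then obtain n where "x1 - x0 = of_int n" by (elim Ints_cases)
  then have "x1 = x0 + of_int n" by simp
  then have "2 * pi * \<i> * of_rat x1 = 2 * pi * \<i> * of_rat x0 + of_real (of_int (2 * n) * pi) * \<i>"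
    by (simp add: of_rat_add algebra_simps)
  then show ?thesis
    unfolding padic_char_def x1_def[symmetric] exp_eq by blast
qed


section \<open>The Fourier transform and band-limited functions\<close>

text \<open>Elements of \<open>L\<^sup>2\<close> are represented by square-integrable functions. Convergence in \<open>L\<^sup>2\<close> is stated
  with the nonnegative integral, so that it is not affected by the default value 0 of the Bochner
  integral at non-integrable functions.\<close>

definition square_integrable :: "'a measure \<Rightarrow> ('a \<Rightarrow> complex) \<Rightarrow> bool" where
  "square_integrable \<mu> f \<longleftrightarrow> f \<in> borel_measurable \<mu> \<and> integrable \<mu> (\<lambda>x. (cmod (f x))\<^sup>2)"

definition L2_tendsto :: "'a measure \<Rightarrow> (nat \<Rightarrow> 'a \<Rightarrow> complex) \<Rightarrow> ('a \<Rightarrow> complex) \<Rightarrow> bool" where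
  "L2_tendsto \<mu> F f \<longleftrightarrow> (\<lambda>n. \<integral>\<^sup>+x. ennreal ((cmod (F n x - f x))\<^sup>2) \<partial>\<mu>) \<longlonglongrightarrow> 0"

definition fourier_L1 ::
  "'p::prime_card padic measure \<Rightarrow> ('p padic \<Rightarrow> complex) \<Rightarrow> 'p padic \<Rightarrow> complex" where
  "fourier_L1 \<mu> f y = (\<integral>x. f x * cnj (padic_char (x * y)) \<partial>\<mu>)"

text \<open>The Plancherel extension: \<open>g\<close> represents the transform of \<open>f\<close> if it is the \<open>L\<^sup>2\<close>-limit of the
  transforms of some sequence in \<open>L\<^sup>1 \<inter> L\<^sup>2\<close> converging to \<open>f\<close> in \<open>L\<^sup>2\<close>. Such a \<open>g\<close> is determined
  almost everywhere, and \<open>fourier_L2\<close> chooses one. Neither of the notions defined from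
  \<open>fourier_L2\<close> below depends on the choice.\<close>

definition is_fourier_L2 ::
  "'p::prime_card padic measure \<Rightarrow> ('p padic \<Rightarrow> complex) \<Rightarrow> ('p padic \<Rightarrow> complex) \<Rightarrow> bool" where
  "is_fourier_L2 \<mu> f g \<longleftrightarrow> square_integrable \<mu> g \<and>
     (\<exists>F. (\<forall>n. integrable \<mu> (F n) \<and> square_integrable \<mu> (F n)) \<and>
          L2_tendsto \<mu> F f \<and> L2_tendsto \<mu> (\<lambda>n. fourier_L1 \<mu> (F n)) g)"

definition fourier_L2 ::
  "'p::prime_card padic measure \<Rightarrow> ('p padic \<Rightarrow> complex) \<Rightarrow> 'p padic \<Rightarrow> complex" where
  "fourier_L2 \<mu> f = (SOME g. is_fourier_L2 \<mu> f g)"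

definition bandlimited ::
  "'p::prime_card padic measure \<Rightarrow> 'p padic set \<Rightarrow> ('p padic \<Rightarrow> complex) set" where
  "bandlimited \<mu> D = {f. square_integrable \<mu> f \<and> (AE y in \<mu>. y \<notin> D \<longrightarrow> fourier_L2 \<mu> f y = 0)}"

definition continuous_rep ::
  "'p::prime_card padic measure \<Rightarrow> 'p padic set \<Rightarrow> ('p padic \<Rightarrow> complex) \<Rightarrow> 'p padic \<Rightarrow> complex" where
  "continuous_rep \<mu> D f x = (LINT y:D|\<mu>. fourier_L2 \<mu> f y * padic_char (x * y))"

definition coset_representatives :: "'a::ab_group_add set \<Rightarrow> 'a set \<Rightarrow> bool" where
  "coset_representatives S A \<longleftrightarrow> (\<forall>x. \<exists>!s. s \<in> S \<and> x - s \<in> A)"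

end

(* The inverse transform of a function supported on p^-m Z_p is invariant under translation by
   p^m Z_p, since the character is trivial on (p^m Z_p) (p^-m Z_p) = Z_p. Hence every x contributes
   through its one representative only. *)
theory Submission
  imports Defs
begin

text \<open>The powers of \<open>p\<close> cancel, as \<open>p\<close> is nonzero in characteristic
  0, and multiplicativity of \<open>padic_norm\<close> keeps the product of the two remaining
  integers in the unit ball.\<close>

lemma padic_ideal_mult_in_ints:
  fixes u v :: "'p::prime_card padic"
  assumes "u \<in> padic_ideal m" "v \<in> padic_ideal (- m)"
  shows "u * v \<in> padic_ints"
proof -
  obtain a b where ab: "a \<in> padic_ints" "b \<in> padic_ints"
    "u = of_nat CARD('p) powi m * a" "v = of_nat CARD('p) powi (- m) * b"
    using assms by (auto simp: padic_ideal_def)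
  have "u * v = a * b"
    by (simp add: ab power_int_minus field_simps)
  then show ?thesis
    using ab(1,2) by (simp add: padic_ints_def padic_norm_mult mult_le_one)
qed

text \<open>By the ultrametric inequality, a fraction admissible for \<open>y\<close> is admissible
  for \<open>x\<close> too, so both characters can be evaluated at the same
  \<open>x0\<close>.\<close>

lemma padic_char_cong:
  fixes x y :: "'p::prime_card padic"
  assumes "x - y \<in> padic_ints"
  shows "padic_char x = padic_char y"
proof -
  obtain x0 where x0: "x0 \<in> p_fractions CARD('p)" "y - of_rat x0 \<in> padic_ints"
    using ex_p_fraction by blast
  have "x - of_rat x0 \<in> padic_ints"
    using padic_norm_add_le_max[of "x - y" "y - of_rat x0"] assms x0(2)
    by (simp add: padic_ints_def)
  then show ?thesis
    using padic_char_eq[OF x0] padic_char_eq[OF x0(1)] by simp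
qed

lemma continuous_rep_cong:
  assumes "x - s \<in> padic_ideal m"
  shows "continuous_rep \<mu> (padic_ideal (- m)) f x = continuous_rep \<mu> (padic_ideal (- m)) f s"
  unfolding continuous_rep_def set_lebesgue_integral_def
\<comment> \<open>The integrands agree at every point: on the ideal because
  \<open>(x - s) * y\<close> is integral, off it because the indicator is 0. Integrability and the
  choice made by \<open>fourier_L2\<close> do not enter.\<close>
proof (intro Bochner_Integration.integral_cong refl)
  fix y
  have "padic_char (x * y) = padic_char (s * y)" if "y \<in> padic_ideal (- m)"
    using padic_char_cong padic_ideal_mult_in_ints[OF assms that]
    by (simp add: left_diff_distrib)
  then show "indicator (padic_ideal (- m)) y *\<^sub>R (fourier_L2 \<mu> f y * padic_char (x * y)) =
    indicator (padic_ideal (- m)) y *\<^sub>R (fourier_L2 \<mu> f y * padic_char (s * y))"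
    by (cases "y \<in> padic_ideal (- m)") simp_all
qed

theorem proposition7p1:
  fixes \<mu> :: "'p::prime_card padic measure"
    and m :: int
    and D S :: "'p padic set"
    and f :: "'p padic \<Rightarrow> complex"
    and x :: "'p padic"
  assumes "haar_measure \<mu>"
    and "D = padic_ideal (- m)"
    and "coset_representatives S (padic_ideal m)"
    and "f \<in> bandlimited \<mu> D"
  shows "((\<lambda>s. indicator ((+) s ` padic_ideal m) x * continuous_rep \<mu> D f s)
           has_sum continuous_rep \<mu> D f x) S"
proof -
  obtain r where r: "r \<in> S" "x - r \<in> padic_ideal m"
    and unique: "\<And>s. s \<in> S \<Longrightarrow> x - s \<in> padic_ideal m \<Longrightarrow> s = r"
    using assms(3) unfolding coset_representatives_def by blast
  \<comment> \<open>Passes from cosets to differences, the form in which \<open>r\<close> is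
    unique.\<close>
  have mem: "x \<in> (+) s ` padic_ideal m \<longleftrightarrow> x - s \<in> padic_ideal m" for s
    by (auto simp: image_iff intro: bexI[of _ "x - s"])
  show ?thesis
  \<comment> \<open>A nonzero term at some other \<open>s\<close> would make \<open>s\<close> a
    second representative of the coset of \<open>x\<close>, so the infinite sum collapses to its
    term at \<open>r\<close>.\<close>
  proof (rule has_sum_finite_neutralI[of "{r}"])
    show "indicator ((+) s ` padic_ideal m) x * continuous_rep \<mu> D f s = 0" if "s \<in> S - {r}" for s
      using that unique[of s] by (auto simp: indicator_def mem)
    show "continuous_rep \<mu> D f x =
        (\<Sum>s\<in>{r}. indicator ((+) s ` padic_ideal m) x * continuous_rep \<mu> D f s)"
      \<comment> \<open>The indicator is 1 at \<open>r\<close>, and the values at \<open>x\<close>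
        and \<open>r\<close> agree by translation invariance.\<close>
      using r(2) continuous_rep_cong[OF r(2)] by (simp add: mem assms(2))
  qed (use r(1) in auto)
qed

end
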